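(* For every nonnegative integer $n$ and every positive integer $r$, the Hyperfibonacci numbers satisfy $$F_n^{(r)} = F_{n+2r} - \sum_{k=0}^{r-1} \binom{n+r-1}{k} F_{r-k+1}.$$
   Context: $F_n$ denotes the Fibonacci numbers, $F_0=0$, $F_1=1$, $F_{n}=F_{n-1}+F_{n-2}$ for $n\ge 2$. The Hyperfibonacci numbers $F_n^{(r)}$ of the $r$th generation ($n,r\ge 0$ integers) are defined by $F_n^{(0)}=F_n$ for $n\ge 0$ and $F_n^{(r)}=\sum_{k=0}^{n}F_k^{(r-1)}$ for $r>0$, $n\ge 0$ (so $F_0^{(r)}=0$ and $F_1^{(r)}=1$ for all $r\ge 0$). *)

theory Defs
  imports "HOL-Number_Theory.Fib"
begin

text \<open>The argument order is \<open>hyperfib r n\<close> = $F_n^{(r)}$.\<close>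

fun hyperfib :: "nat \<Rightarrow> nat \<Rightarrow> nat" where
  "hyperfib 0 n = fib n"
| "hyperfib (Suc r) n = (\<Sum>k = 0..n. hyperfib r k)"

end

theory Submission
  imports Defs
begin

text \<open>
  Writing $S(r, m) = \sum_{k<r} \binom{m}{k} F_{r-k+1}$, Pascal's rule gives
  $S(r+1, m+1) = S(r+1, m) + S(r, m)$. Hence $F_{n+2r} - S(r, n+r-1)$ satisfies the same recurrence
  $F_{n+1}^{(r+1)} = F_n^{(r+1)} + F_{n+1}^{(r)}$ as the Hyperfibonacci numbers, and the boundary
  case $n = 0$ is the identity $\sum_j \binom{p}{j} F_{j+a} = F_{2p+a}$ with $p = r - 1$, $a = 2$.
\<close>

text \<open>Pascal's rule term by term; the term \<open>k = 0\<close> has no lower neighbour, so the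
  second sum is shifted and one term shorter.\<close>

lemma sum_Suc_choose_mult:
  fixes f :: "nat \<Rightarrow> nat"
  shows "(\<Sum>k\<le>r. (Suc m choose k) * f k) =
    (\<Sum>k\<le>r. (m choose k) * f k) + (\<Sum>k<r. (m choose k) * f (Suc k))"
  by (induction r) (simp_all add: algebra_simps)

text \<open>The shift \<open>a\<close> stays general because Pascal's rule splits the sum for
  \<open>Suc p\<close> into those for \<open>p\<close> with shifts \<open>a\<close> and
  \<open>Suc a\<close>.\<close>

lemma sum_choose_fib: "(\<Sum>k\<le>p. (p choose k) * fib (k + a)) = fib (2 * p + a)"
proof (induction p arbitrary: a)
  case 0
  show ?case by simp
next
  case (Suc p)
  have "(\<Sum>k\<le>Suc p. (Suc p choose k) * fib (k + a)) =
      (\<Sum>k\<le>p. (p choose k) * fib (k + a)) + (\<Sum>k\<le>p. (p choose k) * fib (k + Suc a))"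
    \<comment> \<open>The extra term \<open>k = Suc p\<close> of the first sum vanishes.\<close>
    by (simp only: sum_Suc_choose_mult lessThan_Suc_atMost) (simp add: binomial_eq_0)
  also have "\<dots> = fib (2 * Suc p + a)"
    by (simp only: Suc.IH) simp
  finally show ?case .
qed

lemma sum_choose_fib_rev: "(\<Sum>k\<le>p. (p choose k) * fib (p - k + a)) = fib (2 * p + a)"
proof -
  have "(\<Sum>k\<le>p. (p choose k) * fib (p - k + a)) = (\<Sum>k\<le>p. (p choose k) * fib (k + a))"
    by (rule sum.reindex_bij_witness[where i = "\<lambda>k. p - k" and j = "\<lambda>k. p - k"])
      (simp_all add: binomial_symmetric[symmetric])
  then show ?thesis
    by (simp only: sum_choose_fib)
qed

text \<open>The additive form avoids truncated subtraction on naturals.\<close>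

lemma hyperfib_Suc_add_sum:
  "hyperfib (Suc r) n + (\<Sum>k\<le>r. (n + r choose k) * fib (r - k + 2)) = fib (n + 2 * r + 2)"
proof (induction r arbitrary: n)
  case 0
  show ?case
    by (induction n) simp_all
next
  case (Suc r)
  note prev_generation = Suc.IH
  show ?case
  proof (induction n)
    case 0
    have "hyperfib s 0 = 0" for s
      by (induction s) simp_all
    then show ?case
      using sum_choose_fib_rev[of "Suc r" 2] by simp
  next
    case (Suc n)
    \<comment> \<open>Both induction hypotheses share this upper index: in the previous generation,
      at \<open>Suc n\<close>, it reads \<open>Suc n + r\<close>.\<close>
    let ?m = "n + Suc r"
    have "hyperfib (Suc (Suc r)) (Suc n) =
        hyperfib (Suc (Suc r)) n + hyperfib (Suc r) (Suc n)"
      by simp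
    moreover have "(\<Sum>k\<le>Suc r. (Suc ?m choose k) * fib (Suc r - k + 2)) =
        (\<Sum>k\<le>Suc r. (?m choose k) * fib (Suc r - k + 2)) +
        (\<Sum>k\<le>r. (?m choose k) * fib (r - k + 2))"
      unfolding sum_Suc_choose_mult lessThan_Suc_atMost diff_Suc_Suc ..
    moreover have "fib (Suc n + 2 * Suc r + 2) = fib (n + 2 * Suc r + 2) + fib (Suc n + 2 * r + 2)"
      by simp
    ultimately show ?case
      using Suc.IH prev_generation[of "Suc n"] by (simp only: add_Suc add_Suc_right)
  qed
qed

theorem theorem1:
  fixes n r :: nat
  assumes "r > 0"
  shows "int (hyperfib r n) =
    int (fib (n + 2 * r)) -
    (\<Sum>k = 0..r - 1. int ((n + r - 1) choose k) * int (fib (r - k + 1)))"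
proof -
  obtain s where r: "r = Suc s"
    using assms gr0_implies_Suc by blast
  have "(\<Sum>k = 0..r - 1. int ((n + r - 1) choose k) * int (fib (r - k + 1))) =
      int (\<Sum>k\<le>s. (n + s choose k) * fib (s - k + 2))"
    by (simp add: r atLeast0AtMost Suc_diff_le)
  moreover have "int (fib (n + 2 * r)) =
      int (hyperfib r n) + int (\<Sum>k\<le>s. (n + s choose k) * fib (s - k + 2))"
    unfolding r of_nat_add[symmetric] hyperfib_Suc_add_sum by simp
  ultimately show ?thesis
    by simp
qed

end
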